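(* Let $f(n)$ be the largest integer such that every poset on $n$ elements has a subposet on $f(n)$ elements of dimension at most $2$. Then \[ f(n) \leq 4n^{2/3} + o\left(n^{2/3}\right) \quad (n\to\infty). \]
   Context: A subposet of a poset $P$ is a subset of its ground set with the order induced from $P$. The dimension $\dim(P)$ of a poset $P$ is the least integer $d$ such that there are $d$ linear extensions of $P$ whose intersection is $P$ (equivalently, the least $d$ such that $P$ embeds into $\mathbb{R}^d$ with the product order, i.e. $x<y$ in $P$ iff the image of $x$ is coordinatewise below the image of $y$). *)

theory Defs
  imports Complex_Main "HOL-Library.Landau_Symbols"
begin

definition poset_on :: "'a set \<Rightarrow> ('a \<Rightarrow> 'a \<Rightarrow> bool) \<Rightarrow> bool" where
  "poset_on S R \<longleftrightarrow>
     (\<forall>x\<in>S. R x x) \<and>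
     (\<forall>x\<in>S. \<forall>y\<in>S. R x y \<and> R y x \<longrightarrow> x = y) \<and>
     (\<forall>x\<in>S. \<forall>y\<in>S. \<forall>z\<in>S. R x y \<and> R y z \<longrightarrow> R x z)"

definition linear_extension :: "'a set \<Rightarrow> ('a \<Rightarrow> 'a \<Rightarrow> bool) \<Rightarrow> ('a \<Rightarrow> 'a \<Rightarrow> bool) \<Rightarrow> bool" where
  "linear_extension S R L \<longleftrightarrow>
     poset_on S L \<and> (\<forall>x\<in>S. \<forall>y\<in>S. L x y \<or> L y x) \<and>
     (\<forall>x\<in>S. \<forall>y\<in>S. R x y \<longrightarrow> L x y)"

definition order_dim :: "'a set \<Rightarrow> ('a \<Rightarrow> 'a \<Rightarrow> bool) \<Rightarrow> nat" where
  "order_dim S R = (LEAST d. \<exists>Ls. length Ls = d \<and>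
       (\<forall>L\<in>set Ls. linear_extension S R L) \<and>
       (\<forall>x\<in>S. \<forall>y\<in>S. R x y \<longleftrightarrow> (\<forall>L\<in>set Ls. L x y)))"

definition f_sub2 :: "nat \<Rightarrow> nat" where
  "f_sub2 n = Max {k. \<forall>R. poset_on {0..<n} R \<longrightarrow>
       (\<exists>T. T \<subseteq> {0..<n} \<and> card T = k \<and> order_dim T R \<le> 2)}"

end

theory Submission
  imports Defs "HOL-Real_Asymp.Real_Asymp"
begin

text \<open>
  Order the grid $[m]^3$ by letting $p < q$ iff $p \<le> q$ coordinatewise and $p$, $q$ differ in at
  least two coordinates, so that axis-parallel lines are antichains. From a set of more than
  $4m^2$ points delete the largest point of every x-line and the smallest point of every
  y-line, and then twice the largest remaining point of every z-line. Something survives, so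
  there are points $c_1, c_2, c_3$ upwards on one z-line, points $d_1, d_2$ below $c_1, c_2$ on
  their y-lines, and points $g_2, g_3$ above $c_2, c_3$ on their x-lines.

  In a two-dimensional order one of three pairwise incomparable elements lies between the other
  two: it is above every common lower bound and below every common upper bound of them. The
  element $d_1$ shows that this is not $c_1$, and $g_3$ that it is not $c_3$. If it is $c_2$, then
  in one of the two linear orders $d_2$ is above $c_2$ and $g_2$ below $c_2$, although $d_2 < g_2$.
\<close>

section \<open>Realizers\<close>

definition realizer :: "'a set \<Rightarrow> ('a \<Rightarrow> 'a \<Rightarrow> bool) \<Rightarrow> ('a \<Rightarrow> 'a \<Rightarrow> bool) list \<Rightarrow> bool" where
  "realizer S R Ls \<longleftrightarrow>
     (\<forall>L\<in>set Ls. linear_extension S R L) \<and>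
     (\<forall>x\<in>S. \<forall>y\<in>S. R x y \<longleftrightarrow> (\<forall>L\<in>set Ls. L x y))"

lemma linear_extension_total:
  "linear_extension S R L \<Longrightarrow> x \<in> S \<Longrightarrow> y \<in> S \<Longrightarrow> L x y \<or> L y x"
  by (simp add: linear_extension_def)

lemma linear_extension_trans:
  "linear_extension S R L \<Longrightarrow> x \<in> S \<Longrightarrow> y \<in> S \<Longrightarrow> z \<in> S \<Longrightarrow> L x y \<Longrightarrow> L y z \<Longrightarrow> L x z"
  unfolding linear_extension_def poset_on_def by blast

lemma poset_on_if_realizer:
  assumes "realizer S R Ls" "Ls \<noteq> []"
  shows "poset_on S R"
proof -
  have poset: "poset_on S L" if "L \<in> set Ls" for L
    using assms(1) that by (simp add: realizer_def linear_extension_def)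
  have R_iff: "R x y \<longleftrightarrow> (\<forall>L\<in>set Ls. L x y)" if "x \<in> S" "y \<in> S" for x y
    using assms(1) that by (simp add: realizer_def)
  have "R x x" if "x \<in> S" for x
  proof -
    have "L x x" if "L \<in> set Ls" for L
      using poset[OF that] \<open>x \<in> S\<close> by (simp add: poset_on_def)
    then show ?thesis
      using R_iff that by blast
  qed
  moreover have "x = y" if "x \<in> S" "y \<in> S" "R x y \<and> R y x" for x y
  proof -
    obtain L where L: "L \<in> set Ls"
      using assms(2) by (meson last_in_set)
    then have "L x y" "L y x"
      using R_iff that by blast+
    then show ?thesis
      using poset[OF L] that unfolding poset_on_def by blast
  qed
  moreover have "R x z" if "x \<in> S" "y \<in> S" "z \<in> S" "R x y \<and> R y z" for x y z
  proof -
    have "L x z" if L: "L \<in> set Ls" for L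
    proof -
      have "L x y" "L y z"
        using R_iff \<open>x \<in> S\<close> \<open>y \<in> S\<close> \<open>z \<in> S\<close> \<open>R x y \<and> R y z\<close> L by blast+
      then show ?thesis
        using poset[OF L] \<open>x \<in> S\<close> \<open>y \<in> S\<close> \<open>z \<in> S\<close> unfolding poset_on_def by blast
    qed
    then show ?thesis
      using R_iff that by blast
  qed
  ultimately show ?thesis
    unfolding poset_on_def by blast
qed

lemma realizer_pad:
  assumes "poset_on S R" "realizer S R Ls" "length Ls \<le> d"
  obtains Ks where "length Ks = d" "realizer S R Ks"
proof -
  obtain L where L: "linear_extension S R L"
  proof (cases Ls)
    case Nil
    then have "R x y" if "x \<in> S" "y \<in> S" for x y
      using assms(2) that by (simp add: realizer_def)
    then have "linear_extension S R R"
      using assms(1) by (simp add: linear_extension_def)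
    then show thesis ..
  next
    case (Cons L Ls')
    then have "linear_extension S R L"
      using assms(2) by (simp add: realizer_def)
    then show thesis ..
  qed
  have "R x y \<longrightarrow> L x y" if "x \<in> S" "y \<in> S" for x y
    using L that by (simp add: linear_extension_def)
  then have "realizer S R (replicate (d - length Ls) L @ Ls)"
    using assms(2) L by (auto simp: realizer_def)
  moreover have "length (replicate (d - length Ls) L @ Ls) = d"
    using assms(3) by simp
  ultimately show thesis
    using that by blast
qed

text \<open>Without any realizer \<^const>\<open>order_dim\<close> would be the \<^const>\<open>Least\<close> of an empty predicate.\<close>

lemma order_dim_le_iff:
  assumes "poset_on S R" "realizer S R Ls"
  shows "order_dim S R \<le> d \<longleftrightarrow> (\<exists>Ks. length Ks = d \<and> realizer S R Ks)"
proof
  have order_dim: "order_dim S R = (LEAST d. \<exists>Ks. length Ks = d \<and> realizer S R Ks)"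
    by (simp add: order_dim_def realizer_def)
  have "\<exists>Ks. length Ks = order_dim S R \<and> realizer S R Ks"
    unfolding order_dim by (rule LeastI[of _ "length Ls"]) (use assms(2) in blast)
  moreover assume "order_dim S R \<le> d"
  ultimately show "\<exists>Ks. length Ks = d \<and> realizer S R Ks"
    using realizer_pad[OF assms(1)] by metis
next
  assume "\<exists>Ks. length Ks = d \<and> realizer S R Ks"
  then show "order_dim S R \<le> d"
    by (auto simp: order_dim_def realizer_def intro: Least_le)
qed

section \<open>Betweenness in two-dimensional orders\<close>

definition incomparable :: "('a \<Rightarrow> 'a \<Rightarrow> bool) \<Rightarrow> 'a \<Rightarrow> 'a \<Rightarrow> bool" where
  "incomparable R x y \<longleftrightarrow> \<not> R x y \<and> \<not> R y x"

definition between :: "('a \<Rightarrow> 'a \<Rightarrow> bool) \<Rightarrow> ('a \<Rightarrow> 'a \<Rightarrow> bool) \<Rightarrow> 'a \<Rightarrow> 'a \<Rightarrow> 'a \<Rightarrow> bool" where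
  "between L M a b c \<longleftrightarrow>
     L a b \<and> L b c \<and> M c b \<and> M b a \<or> M a b \<and> M b c \<and> L c b \<and> L b a"

locale two_realizer =
  fixes S :: "'a set" and R L M :: "'a \<Rightarrow> 'a \<Rightarrow> bool"
  assumes realizer: "realizer S R [L, M]"
begin

lemma le_iff: "x \<in> S \<Longrightarrow> y \<in> S \<Longrightarrow> R x y \<longleftrightarrow> L x y \<and> M x y"
  using realizer by (simp add: realizer_def)

lemma linear_extension: "linear_extension S R L" "linear_extension S R M"
  using realizer by (simp_all add: realizer_def)

lemmas extensions_total = linear_extension[THEN linear_extension_total]

lemmas extensions_trans = linear_extension[THEN linear_extension_trans]

lemma incomparable_cases:
  assumes "x \<in> S" "y \<in> S" "incomparable R x y"
  shows "L x y \<and> M y x \<or> L y x \<and> M x y"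
  using assms extensions_total le_iff unfolding incomparable_def by metis

lemma between_cases:
  assumes S: "a \<in> S" "b \<in> S" "c \<in> S"
    and "incomparable R a b" "incomparable R a c" "incomparable R b c"
  shows "between L M b a c \<or> between L M a b c \<or> between L M a c b"
proof -
  have "L a b \<and> M b a \<or> L b a \<and> M a b" "L a c \<and> M c a \<or> L c a \<and> M a c"
      "L b c \<and> M c b \<or> L c b \<and> M b c"
    using assms incomparable_cases by simp_all
  moreover have "\<not> (L a c \<and> M a c)" "\<not> (L c a \<and> M c a)"
    using assms le_iff unfolding incomparable_def by blast+
  ultimately show ?thesis
    using extensions_trans[of a b c] extensions_trans[of c b a] S unfolding between_def by blast
qed

lemma between_lower_bound:
  assumes S: "a \<in> S" "b \<in> S" "c \<in> S" "d \<in> S" and "between L M a b c" "R d a" "R d c"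
  shows "R d b"
proof -
  have "L d a" "M d a" "L d c" "M d c"
    using assms le_iff by simp_all
  then show ?thesis
    using \<open>between L M a b c\<close> extensions_trans[of d a b] extensions_trans[of d c b] S
    by (auto simp: between_def le_iff)
qed

lemma between_upper_bound:
  assumes S: "a \<in> S" "b \<in> S" "c \<in> S" "g \<in> S" and "between L M a b c" "R a g" "R c g"
  shows "R b g"
proof -
  have "L a g" "M a g" "L c g" "M c g"
    using assms le_iff by simp_all
  then show ?thesis
    using \<open>between L M a b c\<close> extensions_trans[of b a g] extensions_trans[of b c g] S
    by (auto simp: between_def le_iff)
qed

text \<open>The linear order with $c \<le> b \<le> a$ always has $d \<le> b \<le> g$; the other one has $d \<le> b$ or
  $b \<le> g$ because it has $d \<le> g$.\<close>

lemma between_le_cases: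
  assumes S: "a \<in> S" "b \<in> S" "c \<in> S" "d \<in> S" "g \<in> S"
    and "between L M a b c" "R d c" "R a g" "R d g"
  shows "R d b \<or> R b g"
proof -
  have "L d c" "M d c" "L a g" "M a g" "L d g" "M d g"
    using assms le_iff by simp_all
  then show ?thesis
    using \<open>between L M a b c\<close> S extensions_total[of d b]
      extensions_trans[of d c b] extensions_trans[of b a g] extensions_trans[of b d g]
    by (auto simp: between_def le_iff)
qed

lemma no_middleless_antichain:
  assumes S: "c1 \<in> S" "c2 \<in> S" "c3 \<in> S" "d1 \<in> S" "d2 \<in> S" "g2 \<in> S" "g3 \<in> S"
    and "incomparable R c1 c2" "incomparable R c1 c3" "incomparable R c2 c3"
    and lower_bound: "R d1 c2" "R d1 c3" "\<not> R d1 c1"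
    and upper_bound: "R c1 g3" "R c2 g3" "\<not> R c3 g3"
    and crossing: "R d2 c3" "R c1 g2" "R d2 g2" "\<not> R d2 c2" "\<not> R c2 g2"
  shows False
proof -
  consider (c1_between) "between L M c2 c1 c3" | (c2_between) "between L M c1 c2 c3"
    | (c3_between) "between L M c1 c3 c2"
    using between_cases assms by blast
  then show False
  proof cases
    case c1_between
    then show False
      using between_lower_bound S lower_bound by blast
  next
    case c2_between
    then show False
      using between_le_cases S crossing by blast
  next
    case c3_between
    then show False
      using between_upper_bound S upper_bound by blast
  qed
qed

end

section \<open>Maximal elements of unions of chains\<close>

definition maximals :: "('a \<Rightarrow> 'a \<Rightarrow> bool) \<Rightarrow> 'a set \<Rightarrow> 'a set" where
  "maximals r A = {p \<in> A. \<forall>q\<in>A. \<not> r p q}"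

lemma card_maximals_le:
  assumes "finite A"
    and "\<And>p q. p \<in> A \<Longrightarrow> q \<in> A \<Longrightarrow> \<pi> p = \<pi> q \<Longrightarrow> p \<noteq> q \<Longrightarrow> r p q \<or> r q p"
  shows "card (maximals r A) \<le> card (\<pi> ` A)"
proof (rule card_inj_on_le)
  show "inj_on \<pi> (maximals r A)"
    using assms(2) by (auto simp: inj_on_def maximals_def)
qed (use assms(1) in \<open>auto simp: maximals_def\<close>)

lemma card_maximals_le_mult:
  assumes "finite S" "A \<subseteq> S"
    and "\<And>p q. p \<in> A \<Longrightarrow> q \<in> A \<Longrightarrow> f p = f q \<Longrightarrow> g p = g q \<Longrightarrow> p \<noteq> q \<Longrightarrow> r p q \<or> r q p"
  shows "card (maximals r A) \<le> card (f ` S) * card (g ` S)"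
proof -
  have "card (maximals r A) \<le> card ((\<lambda>p. (f p, g p)) ` A)"
    using assms finite_subset by (intro card_maximals_le) auto
  also have "\<dots> \<le> card (f ` S \<times> g ` S)"
    using assms(1,2) by (intro card_mono) auto
  finally show ?thesis
    by (simp add: card_cartesian_product)
qed

section \<open>The grid order\<close>

definition off_axis_le ::
    "('a \<Rightarrow> 'x::linorder) \<Rightarrow> ('a \<Rightarrow> 'y::linorder) \<Rightarrow> ('a \<Rightarrow> 'z::linorder) \<Rightarrow> 'a \<Rightarrow> 'a \<Rightarrow> bool" where
  "off_axis_le X Y Z p q \<longleftrightarrow> p = q \<or>
     X p \<le> X q \<and> Y p \<le> Y q \<and> Z p \<le> Z q \<and>
     \<not> (X p = X q \<and> Y p = Y q) \<and> \<not> (X p = X q \<and> Z p = Z q) \<and> \<not> (Y p = Y q \<and> Z p = Z q)"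

text \<open>The last key is compared in reverse, so that lines in its direction are traversed downwards.\<close>

definition lex_le ::
    "('a \<Rightarrow> 'x::linorder) \<Rightarrow> ('a \<Rightarrow> 'y::linorder) \<Rightarrow> ('a \<Rightarrow> 'z::linorder) \<Rightarrow> 'a \<Rightarrow> 'a \<Rightarrow> bool" where
  "lex_le a b c p q \<longleftrightarrow>
     a p < a q \<or> a p = a q \<and> (b p < b q \<or> b p = b q \<and> c q \<le> c p)"

lemma lex_le_refl: "lex_le a b c p p"
  by (simp add: lex_le_def)

lemma lex_leI:
  "a p \<le> a q \<Longrightarrow> b p \<le> b q \<Longrightarrow> \<not> (a p = a q \<and> b p = b q) \<Longrightarrow> lex_le a b c p q"
  by (auto simp: lex_le_def)

lemma lex_leD:
  assumes "lex_le a b c p q"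
  shows "a p \<le> a q" "a p = a q \<Longrightarrow> b p \<le> b q" "a p = a q \<Longrightarrow> b p = b q \<Longrightarrow> c q \<le> c p"
  using assms by (auto simp: lex_le_def)

lemma linear_extension_lex_le:
  assumes "inj_on (\<lambda>p. (a p, b p, c p)) S"
    and "\<And>p q. p \<in> S \<Longrightarrow> q \<in> S \<Longrightarrow> R p q \<Longrightarrow> lex_le a b c p q"
  shows "linear_extension S R (lex_le a b c)"
proof -
  have "lex_le a b c p q \<or> lex_le a b c q p" for p q
    by (auto simp: lex_le_def)
  moreover have "p = q" if "p \<in> S" "q \<in> S" "lex_le a b c p q" "lex_le a b c q p" for p q
  proof -
    have "(a p, b p, c p) = (a q, b q, c q)"
      using lex_leD[OF that(3)] lex_leD[OF that(4)] by simp
    then show ?thesis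
      using inj_onD[OF assms(1)] that(1,2) by blast
  qed
  moreover have "lex_le a b c p r" if "lex_le a b c p q" "lex_le a b c q r" for p q r
    using that unfolding lex_le_def by (elim disjE conjE) (auto intro: less_trans)
  ultimately show ?thesis
    using assms(2) unfolding linear_extension_def poset_on_def by blast
qed

locale grid_coordinates =
  fixes S :: "'a set"
    and X :: "'a \<Rightarrow> 'x::linorder" and Y :: "'a \<Rightarrow> 'y::linorder" and Z :: "'a \<Rightarrow> 'z::linorder"
  assumes inj_on_coordinates: "inj_on (\<lambda>p. (X p, Y p, Z p)) S"
begin

abbreviation le :: "'a \<Rightarrow> 'a \<Rightarrow> bool" where
  "le \<equiv> off_axis_le X Y Z"

definition x_less :: "'a \<Rightarrow> 'a \<Rightarrow> bool" where
  "x_less p q \<longleftrightarrow> X p < X q \<and> Y p = Y q \<and> Z p = Z q"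

definition y_less :: "'a \<Rightarrow> 'a \<Rightarrow> bool" where
  "y_less p q \<longleftrightarrow> X p = X q \<and> Y p < Y q \<and> Z p = Z q"

definition z_less :: "'a \<Rightarrow> 'a \<Rightarrow> bool" where
  "z_less p q \<longleftrightarrow> X p = X q \<and> Y p = Y q \<and> Z p < Z q"

lemma eqI:
  assumes "p \<in> S" "q \<in> S" "X p = X q" "Y p = Y q" "Z p = Z q"
  shows "p = q"
  using inj_onD[OF inj_on_coordinates] assms by simp

lemma lex_le_if_le:
  assumes "le p q"
  shows "lex_le X Z Y p q" "lex_le Y X Z p q" "lex_le Z Y X p q"
  using assms unfolding off_axis_le_def by (blast intro: lex_leI lex_le_refl)+

lemma le_iff_lex_le:
  assumes "p \<in> S" "q \<in> S"
  shows "le p q \<longleftrightarrow> lex_le X Z Y p q \<and> lex_le Y X Z p q \<and> lex_le Z Y X p q"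
proof
  assume "lex_le X Z Y p q \<and> lex_le Y X Z p q \<and> lex_le Z Y X p q"
  then have lex: "lex_le X Z Y p q" "lex_le Y X Z p q" "lex_le Z Y X p q"
    by simp_all
  note lexD = lex_leD[OF lex(1)] lex_leD[OF lex(2)] lex_leD[OF lex(3)]
  have "Z p = Z q" if "X p = X q" "Y p = Y q"
    using lexD that by simp
  moreover have "Y p = Y q" if "X p = X q" "Z p = Z q"
    using lexD that by simp
  moreover have "X p = X q" if "Y p = Y q" "Z p = Z q"
    using lexD that by simp
  ultimately show "le p q"
    using lexD eqI[OF assms] unfolding off_axis_le_def by blast
qed (blast intro: lex_le_if_le)

lemma realizer_lex_le: "realizer S le [lex_le X Z Y, lex_le Y X Z, lex_le Z Y X]"
proof -
  have "linear_extension S le (lex_le X Z Y)" "linear_extension S le (lex_le Y X Z)"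
      "linear_extension S le (lex_le Z Y X)"
    by (rule linear_extension_lex_le; simp add: inj_on_def eqI lex_le_if_le)+
  then show ?thesis
    using le_iff_lex_le by (simp add: realizer_def)
qed

lemma poset_on_le: "poset_on S le"
  using realizer_lex_le by (rule poset_on_if_realizer) simp

lemma no_two_realizer:
  assumes "realizer S le [L, M]"
    and S: "c1 \<in> S" "c2 \<in> S" "c3 \<in> S" "d1 \<in> S" "d2 \<in> S" "g2 \<in> S" "g3 \<in> S"
    and lines: "z_less c1 c2" "z_less c2 c3" "y_less d1 c1" "y_less d2 c2"
      "x_less c2 g2" "x_less c3 g3"
  shows False
proof -
  note coordinates = lines[unfolded x_less_def y_less_def z_less_def]
  interpret two_realizer S le L M
    using assms(1) by unfold_locales
  show False
  proof (rule no_middleless_antichain[OF S])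
    show "incomparable le c1 c2" "incomparable le c1 c3" "incomparable le c2 c3"
      using coordinates by (auto simp: incomparable_def off_axis_le_def)
    show "le d1 c2" "le d1 c3" "le c1 g3" "le c2 g3" "le d2 c3" "le c1 g2" "le d2 g2"
      using coordinates by (auto simp: off_axis_le_def)
    show "\<not> le d1 c1" "\<not> le c3 g3" "\<not> le d2 c2" "\<not> le c2 g2"
      using coordinates by (auto simp: off_axis_le_def)
  qed
qed

lemma line_less_total:
  assumes "p \<in> S" "q \<in> S" "p \<noteq> q"
  shows "Y p = Y q \<Longrightarrow> Z p = Z q \<Longrightarrow> x_less p q \<or> x_less q p"
    and "X p = X q \<Longrightarrow> Z p = Z q \<Longrightarrow> y_less p q \<or> y_less q p"
    and "X p = X q \<Longrightarrow> Y p = Y q \<Longrightarrow> z_less p q \<or> z_less q p"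
  using eqI[OF assms(1,2)] assms(3) neq_iff unfolding x_less_def y_less_def z_less_def by metis+

lemma card_maximals_line_le:
  assumes "finite S" "A \<subseteq> S"
  shows "card (maximals x_less A) \<le> card (Y ` S) * card (Z ` S)"
    and "card (maximals y_less\<inverse>\<inverse> A) \<le> card (X ` S) * card (Z ` S)"
    and "card (maximals z_less A) \<le> card (X ` S) * card (Y ` S)"
  by (rule card_maximals_le_mult[OF assms]; use assms(2) line_less_total in \<open>auto simp: subset_iff\<close>)+

lemma subset_maximals_if_two_realizer:
  assumes "realizer S le [L, M]"
    and T_def: "T = S - maximals x_less S - maximals y_less\<inverse>\<inverse> S"
    and U_def: "U = T - maximals z_less T"
  shows "U \<subseteq> maximals z_less U"
proof (rule ccontr)
  assume "\<not> U \<subseteq> maximals z_less U"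
  then obtain c1 c2 where c12: "c1 \<in> U" "c2 \<in> U" "z_less c1 c2"
    by (auto simp: maximals_def)
  then obtain c3 where c3: "c3 \<in> T" "z_less c2 c3"
    by (auto simp: U_def maximals_def)
  have T: "c1 \<in> T" "c2 \<in> T" "T \<subseteq> S"
    using c12 by (auto simp: U_def T_def)
  have "\<exists>g\<in>S. x_less p g" "\<exists>d\<in>S. y_less d p" if "p \<in> T" for p
    using that by (auto simp: T_def maximals_def)
  then obtain d1 d2 g2 g3 where "d1 \<in> S" "d2 \<in> S" "g2 \<in> S" "g3 \<in> S"
      "y_less d1 c1" "y_less d2 c2" "x_less c2 g2" "x_less c3 g3"
    using T c3(1) by metis
  then show False
    using no_two_realizer[OF assms(1), of c1 c2 c3 d1 d2 g2 g3] T c12(3) c3 by blast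
qed

lemma card_le_if_order_dim_le_2:
  assumes "finite S" "order_dim S le \<le> 2"
  shows "card S \<le> card (Y ` S) * card (Z ` S) + card (X ` S) * card (Z ` S)
    + 2 * (card (X ` S) * card (Y ` S))"
proof -
  obtain Ls where "length Ls = 2" "realizer S le Ls"
    using assms(2) order_dim_le_iff[OF poset_on_le realizer_lex_le] by blast
  then obtain L M where LM: "realizer S le [L, M]"
    by (auto simp: numeral_2_eq_2 length_Suc_conv)
  define T where "T = S - maximals x_less S - maximals y_less\<inverse>\<inverse> S"
  define U where "U = T - maximals z_less T"
  have sub: "T \<subseteq> S" "U \<subseteq> S"
    by (auto simp: T_def U_def)
  have "S \<subseteq> maximals x_less S \<union> maximals y_less\<inverse>\<inverse> S \<union> maximals z_less T \<union> maximals z_less U"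
    (is "_ \<subseteq> ?D")
    using subset_maximals_if_two_realizer[OF LM T_def U_def] by (auto simp: T_def U_def)
  moreover have "finite ?D"
    by (rule finite_subset[OF _ assms(1)]) (use sub in \<open>auto simp: maximals_def\<close>)
  ultimately have "card S \<le> card ?D"
    by (intro card_mono)
  also have "\<dots> \<le> card (maximals x_less S) + card (maximals y_less\<inverse>\<inverse> S)
      + card (maximals z_less T) + card (maximals z_less U)"
    by (meson add_le_mono1 card_Un_le order_trans)
  finally show ?thesis
    using card_maximals_line_le(1,2)[OF assms(1) order_refl]
      card_maximals_line_le(3)[OF assms(1) sub(1)] card_maximals_line_le(3)[OF assms(1) sub(2)]
    by linarith
qed

end

section \<open>The upper bound\<close>

lemma ex_subset_card_f_sub2:
  assumes "poset_on {0..<n} R"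
  obtains T where "T \<subseteq> {0..<n}" "card T = f_sub2 n" "order_dim T R \<le> 2"
proof -
  let ?K = "{k. \<forall>R. poset_on {0..<n} R \<longrightarrow>
       (\<exists>T. T \<subseteq> {0..<n} \<and> card T = k \<and> order_dim T R \<le> 2)}"
  have "?K \<subseteq> {..n}"
  proof
    fix k assume "k \<in> ?K"
    then obtain T where "T \<subseteq> {0..<n}" "card T = k"
      using assms by blast
    then show "k \<in> {..n}"
      using card_mono[of "{0..<n}" T] by simp
  qed
  then have "finite ?K"
    by (rule finite_subset) simp
  moreover have "order_dim {} R = 0" for R :: "nat \<Rightarrow> nat \<Rightarrow> bool"
    using order_dim_le_iff[of "{}" R "[]" 0] by (simp add: poset_on_def realizer_def)
  then have "0 \<in> ?K"
    by (auto intro!: exI[of _ "{}"])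
  ultimately have "f_sub2 n \<in> ?K"
    unfolding f_sub2_def using Max_in by blast
  then show thesis
    using assms that by blast
qed

lemma grid_coordinates_digits:
  "grid_coordinates T (\<lambda>i::nat. i mod a) (\<lambda>i. i div a mod b) (\<lambda>i. i div a div b)"
  by unfold_locales (auto intro!: inj_onI, metis div_mult_mod_eq)

lemma f_sub2_le_box:
  assumes "n \<le> a * b * c"
  shows "f_sub2 n \<le> b * c + a * c + 2 * (a * b)"
proof -
  let ?X = "\<lambda>i. i mod a" and ?Y = "\<lambda>i. i div a mod b" and ?Z = "\<lambda>i. i div a div b"
  obtain T where T: "T \<subseteq> {0..<n}" "card T = f_sub2 n" "order_dim T (off_axis_le ?X ?Y ?Z) \<le> 2"
    using ex_subset_card_f_sub2 grid_coordinates.poset_on_le[OF grid_coordinates_digits] .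
  have digits: "i mod a < a" "i div a mod b < b" "i div a div b < c" if "i \<in> T" for i
  proof -
    have "i < a * b * c"
      using that T(1) assms by auto
    then have "a > 0" "b > 0" "i < c * (a * b)"
      by (auto simp: ac_simps intro: Nat.gr0I)
    then show "i mod a < a" "i div a mod b < b" "i div a div b < c"
      by (simp_all add: less_mult_imp_div_less flip: div_mult2_eq)
  qed
  have "?X ` T \<subseteq> {..<a}" "?Y ` T \<subseteq> {..<b}" "?Z ` T \<subseteq> {..<c}"
    using digits by auto
  then have card: "card (?X ` T) \<le> a" "card (?Y ` T) \<le> b" "card (?Z ` T) \<le> c"
    by (metis card_lessThan card_mono finite_lessThan)+
  have "card T \<le> card (?Y ` T) * card (?Z ` T) + card (?X ` T) * card (?Z ` T)
      + 2 * (card (?X ` T) * card (?Y ` T))"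
    using finite_subset[OF T(1)] T(3)
    by (intro grid_coordinates.card_le_if_order_dim_le_2 grid_coordinates_digits) simp_all
  also have "\<dots> \<le> b * c + a * c + 2 * (a * b)"
    using card by (intro add_mono mult_mono) simp_all
  finally show ?thesis
    using T(2) by simp
qed

lemma f_sub2_le_powr: "real (f_sub2 n) \<le> 4 * (real n powr (1/3) + 1)\<^sup>2"
proof -
  define r where "r = real n powr (1/3)"
  define m where "m = nat \<lceil>r\<rceil>"
  have r: "r \<ge> 0" "r ^ 3 = real n"
    by (cases "n = 0"; simp add: r_def powr_power)+
  have m: "r \<le> real m" "real m \<le> r + 1"
    using r(1) unfolding m_def by linarith+
  have "real n \<le> real (m ^ 3)"
    using power_mono[OF m(1) r(1), of 3] r(2) by simp
  then have "n \<le> m * m * m"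
    by (simp only: of_nat_le_iff power3_eq_cube)
  then have "f_sub2 n \<le> 4 * m\<^sup>2"
    using f_sub2_le_box[of n m m m] by (simp add: power2_eq_square)
  then have "real (f_sub2 n) \<le> real (4 * m\<^sup>2)"
    by (simp only: of_nat_le_iff)
  also have "\<dots> \<le> 4 * (r + 1)\<^sup>2"
    using power_mono[OF m(2), of 2] by simp
  finally show ?thesis
    by (simp only: r_def)
qed

theorem theorem1:
  "\<exists>h :: nat \<Rightarrow> real. h \<in> o(\<lambda>n. real n powr (2/3)) \<and>
     (\<forall>n. real (f_sub2 n) \<le> 4 * real n powr (2/3) + h n)"
proof (intro exI conjI allI)
  show "(\<lambda>n. 8 * real n powr (1/3) + 4) \<in> o(\<lambda>n. real n powr (2/3))"
    by real_asymp
  fix n :: nat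
  have "(real n powr (1/3))\<^sup>2 = real n powr (2/3)"
    by (cases "n = 0") (simp_all add: powr_power)
  then have "4 * (real n powr (1/3) + 1)\<^sup>2 = 4 * real n powr (2/3) + (8 * real n powr (1/3) + 4)"
    by (simp add: power2_sum)
  then show "real (f_sub2 n) \<le> 4 * real n powr (2/3) + (8 * real n powr (1/3) + 4)"
    using f_sub2_le_powr[of n] by simp
qed

end
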